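(* Let $S=\{n_1,n_2,\ldots,n_s\}$ be a set of integers with $2\le n_s<\cdots<n_2<n_1$, and suppose $n_1-1\in S$ (i.e. $n_2=n_1-1$). Let $X''=X_{n_1,\ldots,n_s}\setminus\{(n_2,1,\ldots,1)\}$ and let $\mathcal G^*_{n_1,\ldots,n_s}$ be the derived sub-hypergraph of $\mathcal H^*_{n_1,\ldots,n_s}=(X_{n_1,\ldots,n_s},\mathcal C_{n_1,\ldots,n_s},\mathcal D^*_{n_1,\ldots,n_s})$ on $X''$. Then $\mathcal G^*_{n_1,\ldots,n_s}$ is a one-realization of $S$.
   Context: A mixed hypergraph is a triple $\mathcal H=(X,\mathcal C,\mathcal D)$ where $X$ is a finite set and $\mathcal C,\mathcal D$ are families of subsets of $X$ ($\mathcal C$-edges and $\mathcal D$-edges). A proper $k$-coloring is a map from $X$ to a set of $k$ colors such that every $\mathcal C$-edge contains two vertices of a common color and every $\mathcal D$-edge contains two vertices of distinct colors; it is strict if all $k$ colors are used. Colorings are identified with partitions of $X$ into color classes. The feasible set is the set of $k$ for which a strict $k$-coloring exists; $r_k$ is the number of partitions arising as strict $k$-colorings. $\mathcal H$ is a one-realization of $S$ if its feasible set is $S$ and $r_k=1$ for all $k\in S$. The derived sub-hypergraph of $(X,\mathcal C,\mathcal D)$ on $X'\subseteq X$ is $(X',\{C\in\mathcal C: C\subseteq X'\},\{D\in\mathcal D: D\subseteq X'\})$. Notation: $[m]=\{1,\ldots,m\}$. Vertices are $s$-tuples of integers. For $t\in\{2,\ldots,s\}$ and an integer $j$, let $u_t(j)=(j,\ldots,j,n_t,n_{t+1},\ldots,n_s)$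 and $v_t(j)=(j,\ldots,j,1,\ldots,1)$, where in both $j$ is repeated $t-1$ times. Define $X_{n_1,\ldots,n_s}=\{(n_1,\ldots,n_s)\}\cup\{(i,\ldots,i): i\in[n_s-1]\}\cup\{u_t(j),v_t(j): 2\le t\le s,\ n_t\le j\le n_{t-1}-1\}$; $\mathcal C_{n_1,\ldots,n_s}$ = all 3-element subsets $\{(x_1,\ldots,x_s),(y_1,\ldots,y_s),(z_1,\ldots,z_s)\}$ of $X_{n_1,\ldots,n_s}$ with $|\{x_j,y_j,z_j\}|=2$ for every $j\in[s]$; $\mathcal D^*_{n_1,\ldots,n_s}$ = the pairs $\{(i,\ldots,i),(j,\ldots,j)\}$ with $i\neq j$, $i,j\in[n_s-1]$; the pairs $\{(i,\ldots,i),(x_1,\ldots,x_{s-1},n_s)\}$ with $i\in[n_s-1]$ and $(x_1,\ldots,x_{s-1},n_s)\in X_{n_1,\ldots,n_s}$; and the pairs $\{(x_1,\ldots,x_{s-1},1),(y_1,\ldots,y_{s-1},n_s)\}$ of elements of $X_{n_1,\ldots,n_s}$ with $x_i<y_i$ for all $i\in[s-1]$. *)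

theory Defs
  imports Main "HOL-Library.FuncSet"
begin

section \<open>Mixed hypergraphs\<close>

record 'a mixed_hypergraph =
  verts :: "'a set"
  Cedges :: "'a set set"
  Dedges :: "'a set set"

definition is_mixed_hypergraph :: "'a mixed_hypergraph \<Rightarrow> bool" where
  "is_mixed_hypergraph H \<longleftrightarrow>
     finite (verts H) \<and> Cedges H \<subseteq> Pow (verts H) \<and> Dedges H \<subseteq> Pow (verts H)"

text \<open>The set of \<open>k\<close> colors is \<open>{1..k}\<close>. Values of a coloring outside the vertex set are
  irrelevant.\<close>

definition proper_coloring :: "'a mixed_hypergraph \<Rightarrow> nat \<Rightarrow> ('a \<Rightarrow> nat) \<Rightarrow> bool" where
  "proper_coloring H k f \<longleftrightarrow>
     f \<in> verts H \<rightarrow> {1..k} \<and>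
     (\<forall>C \<in> Cedges H. \<exists>x \<in> C. \<exists>y \<in> C. x \<noteq> y \<and> f x = f y) \<and>
     (\<forall>D \<in> Dedges H. \<exists>x \<in> D. \<exists>y \<in> D. f x \<noteq> f y)"

definition strict_coloring :: "'a mixed_hypergraph \<Rightarrow> nat \<Rightarrow> ('a \<Rightarrow> nat) \<Rightarrow> bool" where
  "strict_coloring H k f \<longleftrightarrow> proper_coloring H k f \<and> f ` verts H = {1..k}"

definition color_classes :: "'a mixed_hypergraph \<Rightarrow> ('a \<Rightarrow> nat) \<Rightarrow> 'a set set" where
  "color_classes H f = (\<lambda>c. {x \<in> verts H. f x = c}) ` (f ` verts H)"

definition feasible_set :: "'a mixed_hypergraph \<Rightarrow> nat set" where
  "feasible_set H = {k. \<exists>f. strict_coloring H k f}"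

definition num_strict :: "'a mixed_hypergraph \<Rightarrow> nat \<Rightarrow> nat" where
  "num_strict H k = card {color_classes H f | f. strict_coloring H k f}"

definition one_realization :: "'a mixed_hypergraph \<Rightarrow> nat set \<Rightarrow> bool" where
  "one_realization H S \<longleftrightarrow>
     is_mixed_hypergraph H \<and> feasible_set H = S \<and> (\<forall>k \<in> S. num_strict H k = 1)"

definition derived_sub :: "'a mixed_hypergraph \<Rightarrow> 'a set \<Rightarrow> 'a mixed_hypergraph" where
  "derived_sub H X' =
     \<lparr>verts = X', Cedges = {C \<in> Cedges H. C \<subseteq> X'}, Dedges = {D \<in> Dedges H. D \<subseteq> X'}\<rparr>"


section \<open>The construction\<close>

text \<open>An \<open>s\<close>-tuple is a list of length \<open>s\<close>; \<open>coord x j\<close> is its \<open>j\<close>-th entry, counted from 1.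
  The parameters \<open>n\<^sub>1, \<dots>, n\<^sub>s\<close> are likewise given as one list \<open>n\<close>. All entries of the tuples
  in question are positive integers, so they are taken in \<open>nat\<close>. The construction is only
  used with all \<open>n\<^sub>t \<ge> 2\<close>, so the subtractions do not truncate.\<close>

abbreviation coord :: "nat list \<Rightarrow> nat \<Rightarrow> nat" where
  "coord x j \<equiv> x ! (j - 1)"

definition diag :: "nat list \<Rightarrow> nat \<Rightarrow> nat list" where
  "diag n i = replicate (length n) i"

text \<open>\<open>u_vec n t j = (j, \<dots>, j, n\<^sub>t, \<dots>, n\<^sub>s)\<close> and \<open>v_vec n t j = (j, \<dots>, j, 1, \<dots>, 1)\<close>.\<close>

definition u_vec :: "nat list \<Rightarrow> nat \<Rightarrow> nat \<Rightarrow> nat list" where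
  "u_vec n t j = replicate (t - 1) j @ drop (t - 1) n"

definition v_vec :: "nat list \<Rightarrow> nat \<Rightarrow> nat \<Rightarrow> nat list" where
  "v_vec n t j = replicate (t - 1) j @ replicate (length n - (t - 1)) 1"

definition X_verts :: "nat list \<Rightarrow> nat list set" where
  "X_verts n =
     {n} \<union> {diag n i | i. i \<in> {1..coord n (length n) - 1}}
     \<union> {u_vec n t j | t j. t \<in> {2..length n} \<and> j \<in> {coord n t..coord n (t - 1) - 1}}
     \<union> {v_vec n t j | t j. t \<in> {2..length n} \<and> j \<in> {coord n t..coord n (t - 1) - 1}}"

definition C_edges :: "nat list \<Rightarrow> nat list set set" where
  "C_edges n =
     {C. C \<subseteq> X_verts n \<and> card C = 3 \<and>
         (\<forall>j \<in> {1..length n}. card ((\<lambda>x. coord x j) ` C) = 2)}"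

definition D_star_edges :: "nat list \<Rightarrow> nat list set set" where
  "D_star_edges n = (let s = length n in
     {{diag n i, diag n j} | i j.
        i \<in> {1..coord n s - 1} \<and> j \<in> {1..coord n s - 1} \<and> i \<noteq> j}
     \<union> {{diag n i, x} | i x.
        i \<in> {1..coord n s - 1} \<and> x \<in> X_verts n \<and> coord x s = coord n s}
     \<union> {{x, y} | x y.
        x \<in> X_verts n \<and> y \<in> X_verts n \<and> coord x s = 1 \<and> coord y s = coord n s \<and>
        (\<forall>i \<in> {1..s - 1}. coord x i < coord y i)})"

definition H_star :: "nat list \<Rightarrow> nat list mixed_hypergraph" where
  "H_star n = \<lparr>verts = X_verts n, Cedges = C_edges n, Dedges = D_star_edges n\<rparr>"

text \<open>The removed vertex is \<open>(n\<^sub>2, 1, \<dots>, 1)\<close>.\<close>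

definition G_star :: "nat list \<Rightarrow> nat list mixed_hypergraph" where
  "G_star n =
     derived_sub (H_star n) (X_verts n - {coord n 2 # replicate (length n - 1) 1})"

end

theory Submission
  imports Defs
begin

text \<open>Every vertex is \<open>U\<^sub>j = (min j n\<^sub>1, \<dots>, min j n\<^sub>s)\<close> with \<open>1 \<le> j \<le> n\<^sub>1\<close>, or \<open>V\<^sub>j\<close> with
  \<open>n\<^sub>s \<le> j < n\<^sub>1\<close>, whose \<open>i\<close>-th entry is \<open>j\<close> if \<open>j < n\<^sub>i\<close> and 1 otherwise; the deleted vertex is
  \<open>V\<^sub>j\<close> for \<open>j = n\<^sub>1 - 1\<close>. Each coordinate projection is a strict coloring. Conversely,
  in a proper coloring the \<open>\<C>\<close>-edge \<open>{U\<^sub>1, U\<^sub>j, V\<^sub>j}\<close> gives \<open>V\<^sub>j\<close> the color of \<open>U\<^sub>1\<close> or of \<open>U\<^sub>j\<close>.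
  In the first case the \<open>\<C>\<close>-edges \<open>{U\<^sub>j, U\<^sub>k, V\<^sub>j}\<close> make the color of \<open>U\<^sub>k\<close> constant for \<open>k \<ge> j\<close>; in
  the second the \<open>\<D>\<close>-edges \<open>{V\<^sub>j, U\<^sub>k}\<close> separate \<open>U\<^sub>j\<close> from all later \<open>U\<^sub>k\<close>. So the coloring is
  determined by the least \<open>p\<close> from which on the \<open>U\<^sub>k\<close> have the same color, and if \<open>p\<close> were not in
  \<open>S\<close>, the \<open>\<C>\<close>-edge consisting of \<open>U\<^sub>p\<close>, \<open>V\<^bsub>p-1\<^esub>\<close> and \<open>V\<^sub>p\<close> would have three colors.\<close>

section \<open>Color classes and the pattern of colors, independent of the construction\<close>

lemma color_classes_eqI:
  assumes "\<And>x y. x \<in> verts H \<Longrightarrow> y \<in> verts H \<Longrightarrow> f x = f y \<longleftrightarrow> g x = g y"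
  shows "color_classes H f = color_classes H g"
proof -
  have "{x \<in> verts H. f x = f y} = {x \<in> verts H. g x = g y}" if "y \<in> verts H" for y
    using assms that by blast
  then show ?thesis
    unfolding color_classes_def image_image by (intro image_cong) auto
qed

text \<open>Here \<open>u j\<close> and \<open>v j\<close> stand for the colors of \<open>U\<^sub>j\<close> and \<open>V\<^sub>j\<close>.\<close>

lemma color_pattern:
  fixes u v :: "nat \<Rightarrow> 'c"
  assumes m: "2 \<le> m" "m < N"
    and S: "m \<in> S" "N - 1 \<in> S" "N \<in> S"
    and clique: "\<And>i j. 1 \<le> i \<Longrightarrow> i < m \<Longrightarrow> i < j \<Longrightarrow> j \<le> N \<Longrightarrow> u i \<noteq> u j"
    and v_or: "\<And>j. m \<le> j \<Longrightarrow> j < N - 1 \<Longrightarrow> v j = u 1 \<or> v j = u j"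
    and v_neq: "\<And>j k. m \<le> j \<Longrightarrow> j < N - 1 \<Longrightarrow> j < k \<Longrightarrow> k \<le> N \<Longrightarrow> v j \<noteq> u k"
    and u_or: "\<And>j k. m \<le> j \<Longrightarrow> j < N - 1 \<Longrightarrow> j < k \<Longrightarrow> k \<le> N \<Longrightarrow> v j = u j \<or> u j = u k"
    and gap: "\<And>p. m < p \<Longrightarrow> p < N - 1 \<Longrightarrow> p \<notin> S \<Longrightarrow>
                u p = v (p - 1) \<or> u p = v p \<or> v (p - 1) = v p"
  obtains p where "p \<in> S" "m \<le> p" "p \<le> N" "inj_on u {1..p}"
    and "\<And>j. 1 \<le> j \<Longrightarrow> j \<le> N \<Longrightarrow> u j = u (min j p)"
    and "\<And>j. m \<le> j \<Longrightarrow> j < N - 1 \<Longrightarrow> v j = u (if j < p then j else 1)"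
proof -
  define P where "P j \<longleftrightarrow> m \<le> j \<and> j \<le> N \<and> (\<forall>k. j \<le> k \<and> k \<le> N \<longrightarrow> u k = u j)" for j
  define p where "p = (LEAST j. P j)"
  have "P N" using m by (auto simp: P_def)
  then have "P p" unfolding p_def by (rule LeastI)
  then have p: "m \<le> p" "p \<le> N" and const: "\<And>k. p \<le> k \<Longrightarrow> k \<le> N \<Longrightarrow> u k = u p"
    unfolding P_def by blast+
  have notP: "\<not> P j" if "j < p" for j using that not_less_Least unfolding p_def by blast
  \<comment> \<open>If \<open>v j\<close> differed from \<open>u j\<close>, \<open>u_or\<close>
    would make \<open>u\<close> constant from \<open>j\<close> on, against the minimality of
    \<open>p\<close>.\<close>
  have v_low: "v j = u j" if j: "m \<le> j" "j < N - 1" "j < p" for j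
  proof (rule ccontr)
    assume "v j \<noteq> u j"
    then have "u k = u j" if "j \<le> k" "k \<le> N" for k
      using u_or[OF j(1,2), of k] that by (cases "k = j") auto
    moreover have "j \<le> N" using j by linarith
    ultimately have "P j" using j(1) unfolding P_def by blast
    with notP j show False by blast
  qed
  have u_neq: "u i \<noteq> u j" if ij: "1 \<le> i" "i < j" "j \<le> p" for i j
  proof -
    consider "i < m" | "m \<le> i" "i < N - 1" | "i = N - 1" "m \<le> i" using ij p by linarith
    then show ?thesis
    proof cases
      case 1 then show ?thesis using clique ij p by auto
    next
      case 2 then show ?thesis using v_low[of i] v_neq[of i j] ij p by auto
    next
      \<comment> \<open>No \<open>v\<close> is available at \<open>N - 1\<close>, so minimality of
        \<open>p\<close> is used directly: \<open>P (N - 1)\<close> fails only if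
        \<open>u (N - 1)\<close> and \<open>u N\<close> differ.\<close>
      case 3
      then have "j = N" using ij p by linarith
      moreover have "\<not> P i" using notP ij by simp
      moreover have "k = i \<or> k = N" if "i \<le> k" "k \<le> N" for k using 3 that by linarith
      ultimately show ?thesis using 3 unfolding P_def by (metis diff_le_self)
    qed
  qed
  then have inj: "inj_on u {1..p}"
    by (intro linorder_inj_onI) auto
  \<comment> \<open>Since \<open>u (Suc j) = u j\<close> here, \<open>v_neq\<close> excludes
    \<open>v j = u j\<close> and \<open>v_or\<close> leaves only \<open>u 1\<close>.\<close>
  have v_high: "v j = u 1" if j: "m \<le> j" "j < N - 1" "p \<le> j" for j
  proof -
    have "u (Suc j) = u j" using const[of j] const[of "Suc j"] j by simp
    then show ?thesis using v_or[of j] v_neq[of j "Suc j"] j by auto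
  qed
  have "p \<in> S"
  proof (rule ccontr)
    assume "p \<notin> S"
    with S have "p \<noteq> m" "p \<noteq> N - 1" "p \<noteq> N" by metis+
    \<comment> \<open>Strictness on both sides puts \<open>p - 1\<close> and \<open>p\<close> in the
      range where \<open>v\<close> is controlled.\<close>
    with p have p': "m < p" "p < N - 1" by linarith+
    have "v p = u 1" using v_high p' by simp
    moreover have "v (p - 1) = u (p - 1)" using v_low[of "p - 1"] p' by simp
    moreover have "u (p - 1) \<noteq> u p" "u 1 \<noteq> u p" "u 1 \<noteq> u (p - 1)"
      using p' m by (intro u_neq; linarith)+
    ultimately show False using gap[OF p' \<open>p \<notin> S\<close>] by auto
  qed
  then show ?thesis
  proof (rule that)
    show "u j = u (min j p)" if "1 \<le> j" "j \<le> N" for j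
      using const[of j] that by (cases "j \<le> p") (auto simp: min_def)
    show "v j = u (if j < p then j else 1)" if "m \<le> j" "j < N - 1" for j
      using v_low v_high that by auto
  qed (use p inj in auto)
qed

section \<open>The vertices as two sequences indexed by a single number\<close>

definition U :: "nat list \<Rightarrow> nat \<Rightarrow> nat list" where
  "U n j = map (min j) n"

definition V :: "nat list \<Rightarrow> nat \<Rightarrow> nat list" where
  "V n j = map (\<lambda>a. if j < a then j else 1) n"

lemma length_U [simp]: "length (U n j) = length n"
  and length_V [simp]: "length (V n j) = length n"
  and nth_U [simp]: "i < length n \<Longrightarrow> U n j ! i = min j (n ! i)"
  and nth_V [simp]: "i < length n \<Longrightarrow> V n j ! i = (if j < n ! i then j else 1)"
  by (simp_all add: U_def V_def)

locale construction =
  fixes n :: "nat list"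
  assumes dec: "sorted_wrt (>) n"
    and len: "2 \<le> length n"
    and last_ge: "2 \<le> n ! (length n - 1)"
begin

abbreviation m where "m \<equiv> n ! (length n - 1)"
abbreviation N where "N \<equiv> n ! 0"

lemma nonempty [simp]: "n \<noteq> []"
  using len by auto

lemma nth_less: "i < k \<Longrightarrow> k < length n \<Longrightarrow> n ! k < n ! i"
  using dec by (simp add: sorted_wrt_iff_nth_less)

lemma nth_mono: "i \<le> k \<Longrightarrow> k < length n \<Longrightarrow> n ! k \<le> n ! i"
  using nth_less by (metis le_less order_refl)

lemma nth_bounds: "i < length n \<Longrightarrow> m \<le> n ! i \<and> n ! i \<le> N"
  using nth_mono[of i "length n - 1"] nth_mono[of 0 i] by simp

lemma m_less_N: "m < N"
  using nth_less[of 0 "length n - 1"] len by simp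

lemma diag_eq_U: "i < m \<Longrightarrow> diag n i = U n i"
  using nth_bounds by (intro nth_equalityI) (fastforce simp: diag_def)+

lemma top_eq_U: "n = U n N"
  using nth_bounds by (intro nth_equalityI) (fastforce simp: min_def)+

text \<open>All entries are at least 2, so \<open>coord n (t - 1) - 1\<close> does not truncate and
  the upper bound on \<open>j\<close> becomes strict.\<close>

lemma level_bounds:
  assumes "t \<in> {2..length n}" "j \<in> {coord n t..coord n (t - 1) - 1}"
  shows "coord n t \<le> j" "j < coord n (t - 1)" "m \<le> j" "j < N"
proof -
  have "t - 1 < length n" "t - 1 - 1 < length n" using assms(1) by auto
  then have "m \<le> coord n t" "m \<le> coord n (t - 1)" "coord n (t - 1) \<le> N"
    using nth_bounds by blast+
  then show "coord n t \<le> j" "j < coord n (t - 1)" "m \<le> j" "j < N"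
    using assms(2) last_ge unfolding atLeastAtMost_iff by linarith+
qed

lemma u_vec_eq_U:
  assumes "t \<in> {2..length n}" "j \<in> {coord n t..coord n (t - 1) - 1}"
  shows "u_vec n t j = U n j"
proof (rule nth_equalityI)
  note j = level_bounds(1,2)[OF assms]
  fix i assume "i < length (u_vec n t j)"
  then have i: "i < length n" using assms by (auto simp: u_vec_def)
  then show "u_vec n t j ! i = U n j ! i"
    using assms(1) j nth_mono[of i "t - 1 - 1"] nth_mono[of "t - 1" i]
    by (cases "i < t - 1"; force simp: u_vec_def nth_append min_def)
qed (use assms in \<open>auto simp: u_vec_def\<close>)

lemma v_vec_eq_V:
  assumes "t \<in> {2..length n}" "j \<in> {coord n t..coord n (t - 1) - 1}"
  shows "v_vec n t j = V n j"
proof (rule nth_equalityI)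
  note j = level_bounds(1,2)[OF assms]
  fix i assume "i < length (v_vec n t j)"
  then have i: "i < length n" using assms by (auto simp: v_vec_def)
  then show "v_vec n t j ! i = V n j ! i"
    using assms(1) j nth_mono[of i "t - 1 - 1"] nth_mono[of "t - 1" i]
    by (cases "i < t - 1"; force simp: v_vec_def nth_append)
qed (use assms in \<open>auto simp: v_vec_def\<close>)

lemma level_exists:
  assumes "m \<le> j" "j < N"
  obtains t where "t \<in> {2..length n}" "j \<in> {coord n t..coord n (t - 1) - 1}"
proof -
  \<comment> \<open>Positions count from 0, so \<open>t\<close> is \<open>Suc i\<close>; minimality
    of \<open>i\<close> supplies the upper bound on \<open>j\<close>.\<close>
  define i where "i = (LEAST i. n ! i \<le> j)"
  have "n ! i \<le> j" unfolding i_def using assms(1) by (rule LeastI)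
  have "i \<le> length n - 1" unfolding i_def using assms(1) by (rule Least_le)
  have "i \<noteq> 0" using \<open>n ! i \<le> j\<close> assms(2) by (metis not_le)
  then have "j < n ! (i - 1)"
    using not_less_Least[of "i - 1" "\<lambda>i. n ! i \<le> j"] unfolding i_def by force
  with \<open>n ! i \<le> j\<close> \<open>i \<le> length n - 1\<close> \<open>i \<noteq> 0\<close> len show ?thesis
    by (intro that[of "Suc i"]) auto
qed

text \<open>The intervals from \<open>coord n t\<close> to \<open>coord n (t - 1) - 1\<close> tile
  \<open>{m..<N}\<close>, so \<open>j\<close> alone determines the level \<open>t\<close>. The
  diagonal vertices and \<open>n\<close> fill the remaining indices of \<open>U\<close>.\<close>

lemma X_verts_eq: "X_verts n = U n ` {1..N} \<union> V n ` {m..<N}"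
proof (intro equalityI subsetI)
  fix x assume "x \<in> X_verts n"
  then consider "x = n" | i where "x = diag n i" "1 \<le> i" "i < m"
    | t j where "t \<in> {2..length n}" "j \<in> {coord n t..coord n (t - 1) - 1}"
        "x = u_vec n t j \<or> x = v_vec n t j"
    using last_ge unfolding X_verts_def by fastforce
  then show "x \<in> U n ` {1..N} \<union> V n ` {m..<N}"
  proof cases
    case 1
    then have "x = U n N" using top_eq_U by (rule trans)
    then show ?thesis using m_less_N by auto
  next
    case 2 then show ?thesis using diag_eq_U m_less_N by auto
  next
    case 3
    then show ?thesis
      using level_bounds(3,4)[OF 3(1,2)] u_vec_eq_U[OF 3(1,2)] v_vec_eq_V[OF 3(1,2)] last_ge by auto
  qed
next
  fix x assume "x \<in> U n ` {1..N} \<union> V n ` {m..<N}"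
  then consider i where "x = U n i" "1 \<le> i" "i \<le> N" | j where "x = V n j" "m \<le> j" "j < N"
    by auto
  then consider "x = U n N" | i where "x = U n i" "1 \<le> i" "i < m"
    | j where "m \<le> j" "j < N" "x = U n j \<or> x = V n j"
    by (metis linorder_not_le nat_less_le)
  then show "x \<in> X_verts n"
  proof cases
    case 1
    then have "x = n" using top_eq_U[symmetric] by (rule trans)
    then show ?thesis by (simp add: X_verts_def)
  next
    case 2 then show ?thesis using diag_eq_U[of i] by (fastforce simp: X_verts_def)
  next
    case 3
    obtain t where t: "t \<in> {2..length n}" "j \<in> {coord n t..coord n (t - 1) - 1}"
      using level_exists 3(1,2) by blast
    then have "u_vec n t j \<in> X_verts n" "v_vec n t j \<in> X_verts n"
      unfolding X_verts_def by blast+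
    then show ?thesis
      using 3(3) by (auto simp: u_vec_eq_U[OF t] v_vec_eq_V[OF t])
  qed
qed

section \<open>Coordinate projections respect all edges\<close>

lemma nth_vertex_bounds:
  assumes "x \<in> X_verts n" "i < length n"
  shows "1 \<le> x ! i" "x ! i \<le> n ! i"
  using assms nth_bounds[of i] last_ge by (auto simp: X_verts_eq)

lemma nth_neq_of_D_star_edge:
  assumes "D \<in> D_star_edges n" "i < length n"
  shows "\<exists>x\<in>D. \<exists>y\<in>D. x ! i \<noteq> y ! i"
proof -
  from assms(1) consider
      a b where "D = {diag n a, diag n b}" "a \<noteq> b"
    | a x where "D = {diag n a, x}" "a \<in> {1..m - 1}" "x \<in> X_verts n" "x ! (length n - 1) = m"
    | x y where "D = {x, y}" "x ! (length n - 1) = 1" "y ! (length n - 1) = m"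
        "\<forall>k \<in> {1..length n - 1}. coord x k < coord y k"
    unfolding D_star_edges_def Let_def by blast
  then show ?thesis
  proof cases
    case 1 then show ?thesis using assms(2) by (auto simp: diag_def)
  next
    case 2
    \<comment> \<open>A vertex with last entry \<open>m\<close> is some \<open>U n j\<close> with
      \<open>m \<le> j\<close>, because every \<open>V n j\<close> ends in 1. Hence all its entries
      exceed \<open>a\<close>.\<close>
    have "m \<le> x ! i"
      using 2(2-4) nth_bounds[OF assms(2)] last_ge nth_bounds[of "length n - 1"] len assms(2)
      by (auto simp: X_verts_eq split: if_splits)
    then show ?thesis using 2(1,2) assms(2) by (fastforce simp: diag_def)
  next
    case 3
    have "x ! i \<noteq> y ! i"
    proof (cases "i = length n - 1")
      case True then show ?thesis using 3(2,3) last_ge by simp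
    next
      case False
      then have "Suc i \<in> {1..length n - 1}" using assms(2) by auto
      then show ?thesis using 3(4) by fastforce
    qed
    then show ?thesis using 3(1) by blast
  qed
qed

lemma nth_eq_of_C_edge:
  assumes "C \<in> C_edges n" "i < length n"
  shows "\<exists>x\<in>C. \<exists>y\<in>C. x \<noteq> y \<and> x ! i = y ! i"
proof -
  have "card C = 3" "Suc i \<in> {1..length n}" using assms by (auto simp: C_edges_def)
  moreover from this have "card ((\<lambda>x. x ! i) ` C) = 2"
    using assms unfolding C_edges_def by fastforce
  ultimately have "\<not> inj_on (\<lambda>x. x ! i) C" using card_image by fastforce
  then show ?thesis by (auto simp: inj_on_def)
qed

section \<open>Edges that constrain every coloring\<close>

text \<open>If \<open>j < m\<close>, both vertices are diagonal; otherwise \<open>U n j\<close> ends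
  in \<open>m\<close> and the pair belongs to the second family.\<close>

lemma D_star_U_U:
  assumes "1 \<le> i" "i < m" "i < j" "j \<le> N"
  shows "{U n i, U n j} \<in> D_star_edges n"
proof (cases "j < m")
  case True
  then show ?thesis
    unfolding D_star_edges_def Let_def using assms
    by (intro UnI1 CollectI exI[of _ i] exI[of _ j]) (auto simp: diag_eq_U)
next
  case False
  then show ?thesis
    unfolding D_star_edges_def Let_def using assms len
    by (intro UnI1 UnI2 CollectI exI[of _ i] exI[of _ "U n j"])
      (auto simp: diag_eq_U X_verts_eq)
qed

text \<open>An entry of \<open>V n j\<close> is \<open>j\<close>, when \<open>j < n ! i\<close>, or
  1; either is below \<open>min k (n ! i)\<close>.\<close>

lemma D_star_V_U:
  assumes "m \<le> j" "j < k" "k \<le> N"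
  shows "{V n j, U n k} \<in> D_star_edges n"
proof -
  have "coord (V n j) i < coord (U n k) i" if "i \<in> {1..length n - 1}" for i
  proof -
    have "i - 1 < length n" using that by auto
    then show ?thesis using assms nth_bounds[of "i - 1"] last_ge by auto
  qed
  then show ?thesis
    unfolding D_star_edges_def Let_def using assms len last_ge
    by (intro UnI2 CollectI exI[of _ "V n j"] exI[of _ "U n k"])
      (auto simp: X_verts_eq)
qed

lemma C_edgeI:
  assumes "{x, y, z} \<subseteq> X_verts n" "x \<noteq> y" "x \<noteq> z" "y \<noteq> z"
    and "\<And>i. i < length n \<Longrightarrow> card {x ! i, y ! i, z ! i} = 2"
  shows "{x, y, z} \<in> C_edges n"
  using assms by (auto simp: C_edges_def)

lemma U_inj: "i \<le> N \<Longrightarrow> j \<le> N \<Longrightarrow> U n i = U n j \<Longrightarrow> i = j"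
  using nth_U[of 0 n i] nth_U[of 0 n j] len by (metis min.absorb1 not_numeral_le_zero not_gr_zero)

text \<open>The last entry separates them: it is 1 in \<open>V n k\<close> and at least 2 in
  \<open>U n j\<close>. For \<open>j = 1\<close> the first entry has to be used instead.\<close>

lemma U_neq_V:
  assumes "m \<le> k" "2 \<le> j"
  shows "U n j \<noteq> V n k"
proof -
  have "U n j ! (length n - 1) \<noteq> V n k ! (length n - 1)"
    using assms last_ge by auto
  then show ?thesis by metis
qed

lemma U1_neq_V:
  assumes "m \<le> k" "k < N"
  shows "U n 1 \<noteq> V n k"
proof -
  have "U n 1 ! 0 \<noteq> V n k ! 0"
    using assms last_ge by auto
  then show ?thesis by metis
qed

lemma V_inj: "i < N \<Longrightarrow> j < N \<Longrightarrow> V n i = V n j \<Longrightarrow> i = j"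
  using nth_V[of 0 n i] nth_V[of 0 n j] len by (metis not_numeral_le_zero not_gr_zero)

text \<open>At each position \<open>V n j\<close> copies \<open>U n j\<close> if
  \<open>j < n ! i\<close> and \<open>U n 1\<close> otherwise, while these two differ
  everywhere.\<close>

lemma C_edge_U1_U_V:
  assumes "m \<le> j" "j < N"
  shows "{U n 1, U n j, V n j} \<in> C_edges n"
proof (rule C_edgeI)
  show "U n 1 \<noteq> U n j" using U_inj[of 1 j] assms last_ge by auto
  show "card {U n 1 ! i, U n j ! i, V n j ! i} = 2" if "i < length n" for i
    using that assms nth_bounds[of i] last_ge by (auto simp: card_2_iff' min_def)
qed (use assms last_ge U_neq_V U1_neq_V in \<open>auto simp: X_verts_eq\<close>)

text \<open>Where \<open>j < n ! i\<close>, \<open>U n j\<close> agrees with \<open>V n j\<close>;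
  elsewhere it agrees with \<open>U n k\<close>. The third vertex differs in both cases.\<close>

lemma C_edge_U_U_V:
  assumes "m \<le> j" "j < k" "k \<le> N"
  shows "{U n j, U n k, V n j} \<in> C_edges n"
proof (rule C_edgeI)
  show "U n j \<noteq> U n k" using U_inj[of j k] assms by auto
  show "card {U n j ! i, U n k ! i, V n j ! i} = 2" if "i < length n" for i
    using that assms nth_bounds[of i] last_ge by (auto simp: card_2_iff' min_def)
qed (use assms last_ge U_neq_V in \<open>auto simp: X_verts_eq\<close>)

text \<open>Where \<open>n ! i < p\<close>, both \<open>V\<close> entries are 1; where
  \<open>p < n ! i\<close>, \<open>U n p\<close> and \<open>V n p\<close> share the entry
  \<open>p\<close>. A position with \<open>n ! i = p\<close> would show the three values
  \<open>p\<close>, \<open>p - 1\<close> and 1.\<close>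

lemma C_edge_gap:
  assumes "m < p" "p < N" "p \<notin> set n"
  shows "{U n p, V n (p - 1), V n p} \<in> C_edges n"
proof (rule C_edgeI)
  show "V n (p - 1) \<noteq> V n p"
  proof
    assume "V n (p - 1) = V n p"
    then have "p - 1 = p" using assms by (intro V_inj) auto
    then show False using assms by simp
  qed
  have "p - 1 \<in> {m..<N}" using assms by auto
  then show "{U n p, V n (p - 1), V n p} \<subseteq> X_verts n"
    using assms last_ge by (auto simp: X_verts_eq)
  show "card {U n p ! i, V n (p - 1) ! i, V n p ! i} = 2" if "i < length n" for i
  proof -
    have "n ! i \<noteq> p" using that assms by auto
    then have "n ! i < p \<or> p < n ! i" by linarith
    then show ?thesis
      using that assms nth_bounds[of i] last_ge by (auto simp: card_2_iff' min_def)
  qed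
qed (use assms last_ge U_neq_V in \<open>auto simp: X_verts_eq\<close>)

end

section \<open>Colorings after deletion of the vertex\<close>

locale consecutive_construction = construction +
  assumes second: "n ! 1 = n ! 0 - 1"
begin

text \<open>By \<open>second\<close>, only the first entry of \<open>n\<close> exceeds
  \<open>N - 1\<close>.\<close>

lemma removed_eq_V: "coord n 2 # replicate (length n - 1) 1 = V n (N - 1)"
proof (rule nth_equalityI)
  fix i assume "i < length (coord n 2 # replicate (length n - 1) 1)"
  then have "i < length n" using len by auto
  then show "(coord n 2 # replicate (length n - 1) 1) ! i = V n (N - 1) ! i"
    using len nth_mono[of 1 i] second nth_less[of 0 1] by (cases i) auto
qed (use len in auto)

lemma verts_eq: "verts (G_star n) = U n ` {1..N} \<union> V n ` {m..<N - 1}"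
proof -
  have "U n j \<noteq> V n (N - 1)" if "1 \<le> j" for j
    using that U_neq_V[of "N - 1" j] U1_neq_V[of "N - 1"] m_less_N by (cases "j = 1") auto
  then have "V n (N - 1) \<notin> U n ` {1..N}" by fastforce
  moreover have "V n (N - 1) \<noteq> V n j" if "j < N - 1" for j
    using that V_inj[of j "N - 1"] by fastforce
  then have "V n (N - 1) \<notin> V n ` {m..<N - 1}" by fastforce
  moreover have "{m..<N} = insert (N - 1) {m..<N - 1}"
    using m_less_N by auto
  ultimately show ?thesis
    unfolding G_star_def derived_sub_def removed_eq_V X_verts_eq by auto
qed

lemma Cedges_eq: "Cedges (G_star n) = {C \<in> C_edges n. C \<subseteq> verts (G_star n)}"
  and Dedges_eq: "Dedges (G_star n) = {D \<in> D_star_edges n. D \<subseteq> verts (G_star n)}"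
  by (simp_all add: G_star_def derived_sub_def H_star_def)

lemma verts_subset: "verts (G_star n) \<subseteq> X_verts n"
  by (auto simp: G_star_def derived_sub_def)

lemma is_mixed_hypergraph_G_star: "is_mixed_hypergraph (G_star n)"
  by (auto simp: is_mixed_hypergraph_def Cedges_eq Dedges_eq) (simp add: verts_eq)

text \<open>Deletion loses no color: each color \<open>c\<close> is attained at
  \<open>U n c\<close>, and no \<open>U\<close> vertex is deleted.\<close>

lemma strict_coloring_nth:
  assumes i: "i < length n"
  shows "strict_coloring (G_star n) (n ! i) (\<lambda>x. x ! i)"
proof -
  have "c \<in> (\<lambda>x. x ! i) ` verts (G_star n)" if "c \<in> {1..n ! i}" for c
    using that i nth_bounds[OF i] by (intro image_eqI[of _ _ "U n c"]) (auto simp: verts_eq)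
  moreover have "x ! i \<in> {1..n ! i}" if "x \<in> verts (G_star n)" for x
    using that nth_vertex_bounds[OF _ i] verts_subset by auto
  ultimately show ?thesis
    using nth_neq_of_D_star_edge[OF _ i] nth_eq_of_C_edge[OF _ i]
    by (auto simp: strict_coloring_def proper_coloring_def Cedges_eq Dedges_eq image_subset_iff)
qed

text \<open>Up to renaming colors, a proper coloring is a coordinate projection; the position
  \<open>i\<close> is that of the threshold \<open>p\<close> from
  \<open>color_pattern\<close>.\<close>

lemma proper_coloring_factors:
  assumes "proper_coloring (G_star n) k f"
  obtains i where "i < length n" "inj_on (\<lambda>j. f (U n j)) {1..n ! i}"
    and "\<And>x. x \<in> verts (G_star n) \<Longrightarrow> f x = f (U n (x ! i))"
proof -
  have C: "f x = f y \<or> f x = f z \<or> f y = f z"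
    if "{x, y, z} \<in> C_edges n" "{x, y, z} \<subseteq> verts (G_star n)" for x y z
  proof -
    have "{x, y, z} \<in> Cedges (G_star n)" using that Cedges_eq by blast
    then have "\<exists>a\<in>{x, y, z}. \<exists>b\<in>{x, y, z}. a \<noteq> b \<and> f a = f b"
      using assms unfolding proper_coloring_def by blast
    then show ?thesis by auto
  qed
  have D: "f x \<noteq> f y" if "{x, y} \<in> D_star_edges n" "{x, y} \<subseteq> verts (G_star n)" for x y
  proof -
    have "{x, y} \<in> Dedges (G_star n)" using that Dedges_eq by blast
    then have "\<exists>a\<in>{x, y}. \<exists>b\<in>{x, y}. f a \<noteq> f b"
      using assms unfolding proper_coloring_def by blast
    then show ?thesis by auto
  qed
  let ?u = "\<lambda>j. f (U n j)" and ?v = "\<lambda>j. f (V n j)"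
  have clique: "?u i \<noteq> ?u j" if "1 \<le> i" "i < m" "i < j" "j \<le> N" for i j
    using that D[OF D_star_U_U[OF that]] by (auto simp: verts_eq)
  have v_neq: "?v j \<noteq> ?u k" if "m \<le> j" "j < N - 1" "j < k" "k \<le> N" for j k
    using that D[OF D_star_V_U[of j k]] by (auto simp: verts_eq)
  \<comment> \<open>The third way to satisfy the edge, \<open>?u 1 = ?u j\<close>, is ruled out by
    \<open>clique\<close>.\<close>
  have v_or: "?v j = ?u 1 \<or> ?v j = ?u j" if "m \<le> j" "j < N - 1" for j
    using that C[OF C_edge_U1_U_V[of j]] clique[of 1 j] last_ge by (auto simp: verts_eq)
  have u_or: "?v j = ?u j \<or> ?u j = ?u k" if "m \<le> j" "j < N - 1" "j < k" "k \<le> N" for j k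
    using that C[OF C_edge_U_U_V[of j k]] v_neq[of j k] last_ge by (auto simp: verts_eq)
  have gap: "?u p = ?v (p - 1) \<or> ?u p = ?v p \<or> ?v (p - 1) = ?v p"
    if "m < p" "p < N - 1" "p \<notin> set n" for p
  proof -
    have "p - 1 \<in> {m..<N - 1}" using that by auto
    then show ?thesis using that C[OF C_edge_gap[of p]] last_ge by (auto simp: verts_eq)
  qed
  \<comment> \<open>\<open>N - 1\<close> comes from \<open>second\<close>; it covers the threshold
    \<open>N - 1\<close>, whose gap edge would contain the deleted vertex.\<close>
  have "m \<in> set n" "N \<in> set n" "N - 1 \<in> set n"
    using len second nth_mem[of 0 n] nth_mem[of 1 n] nth_mem[of "length n - 1" n]
    by (auto simp del: nth_mem)
  then obtain p where p: "p \<in> set n" "m \<le> p" "p \<le> N" "inj_on ?u {1..p}"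
    and u: "\<And>j. 1 \<le> j \<Longrightarrow> j \<le> N \<Longrightarrow> ?u j = ?u (min j p)"
    and v: "\<And>j. m \<le> j \<Longrightarrow> j < N - 1 \<Longrightarrow> ?v j = ?u (if j < p then j else 1)"
    using color_pattern[of m N "set n" ?u ?v, OF last_ge m_less_N _ _ _ clique v_or v_neq u_or gap]
    by blast
  obtain i where i: "i < length n" "p = n ! i" using p(1) by (auto simp: in_set_conv_nth)
  show ?thesis
  proof (rule that[OF i(1)])
    show "inj_on ?u {1..n ! i}" using p i by simp
    \<comment> \<open>For \<open>p = n ! i\<close>, the indices in \<open>u\<close> and
      \<open>v\<close> are exactly the \<open>i\<close>-th entries of \<open>U n j\<close> and
      \<open>V n j\<close>.\<close>
    show "f x = f (U n (x ! i))" if "x \<in> verts (G_star n)" for x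
      using that u v i unfolding verts_eq by auto
  qed
qed

lemma strict_coloring_unique:
  assumes "strict_coloring (G_star n) k f"
  obtains i where "i < length n" "k = n ! i"
    and "color_classes (G_star n) f = color_classes (G_star n) (\<lambda>x. x ! i)"
proof -
  have f: "proper_coloring (G_star n) k f" "f ` verts (G_star n) = {1..k}"
    using assms by (auto simp: strict_coloring_def)
  obtain i where i: "i < length n" and inj: "inj_on (\<lambda>j. f (U n j)) {1..n ! i}"
    and fac: "\<And>x. x \<in> verts (G_star n) \<Longrightarrow> f x = f (U n (x ! i))"
    using proper_coloring_factors[OF f(1)] by blast
  have im: "(\<lambda>x. x ! i) ` verts (G_star n) = {1..n ! i}"
    using strict_coloring_nth[OF i] by (simp add: strict_coloring_def)
  have "f ` verts (G_star n) = (\<lambda>j. f (U n j)) ` (\<lambda>x. x ! i) ` verts (G_star n)"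
    unfolding image_image using fac by (intro image_cong) auto
  \<comment> \<open>Strictness enters here: counting the colors used identifies
    \<open>k\<close>.\<close>
  then have "card {1..k} = card {1..n ! i}"
    unfolding im f(2) using card_image[OF inj] by simp
  then have "k = n ! i" by simp
  moreover have "color_classes (G_star n) f = color_classes (G_star n) (\<lambda>x. x ! i)"
  proof (rule color_classes_eqI)
    fix x y assume xy: "x \<in> verts (G_star n)" "y \<in> verts (G_star n)"
    then have "x ! i \<in> {1..n ! i}" "y ! i \<in> {1..n ! i}" using im by blast+
    then show "f x = f y \<longleftrightarrow> x ! i = y ! i"
      using inj_on_eq_iff[OF inj] fac[OF xy(1)] fac[OF xy(2)] by simp
  qed
  ultimately show ?thesis using that i by blast
qed

lemma nth_inj: "i < length n \<Longrightarrow> k < length n \<Longrightarrow> n ! i = n ! k \<Longrightarrow> i = k"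
  using nth_less[of i k] nth_less[of k i] by (metis less_irrefl linorder_neqE_nat)

lemma one_realization_G_star: "one_realization (G_star n) (set n)"
proof -
  have "feasible_set (G_star n) = set n"
  proof (intro equalityI subsetI)
    show "k \<in> set n" if k: "k \<in> feasible_set (G_star n)" for k
    proof -
      obtain f where "strict_coloring (G_star n) k f"
        using k by (auto simp: feasible_set_def)
      then obtain i where "i < length n" "k = n ! i" by (rule strict_coloring_unique)
      then show ?thesis by simp
    qed
    show "k \<in> feasible_set (G_star n)" if "k \<in> set n" for k
      using that strict_coloring_nth by (auto simp: feasible_set_def in_set_conv_nth)
  qed
  moreover have "num_strict (G_star n) k = 1" if k: "k \<in> set n" for k
  proof -
    obtain i where i: "i < length n" "k = n ! i" using k by (auto simp: in_set_conv_nth)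
    have "color_classes (G_star n) f = color_classes (G_star n) (\<lambda>x. x ! i)"
      if "strict_coloring (G_star n) k f" for f
      using that
    proof (rule strict_coloring_unique)
      fix l assume l: "l < length n" "k = n ! l"
        and *: "color_classes (G_star n) f = color_classes (G_star n) (\<lambda>x. x ! l)"
      \<comment> \<open>The entries of \<open>n\<close> are distinct, so \<open>k\<close> fixes the
        projection.\<close>
      have "l = i" using nth_inj l i by simp
      with * show ?thesis by simp
    qed
    moreover have "strict_coloring (G_star n) k (\<lambda>x. x ! i)"
      using strict_coloring_nth i by simp
    ultimately have "{color_classes (G_star n) f | f. strict_coloring (G_star n) k f}
      = {color_classes (G_star n) (\<lambda>x. x ! i)}"
      by blast
    then show ?thesis by (simp add: num_strict_def)
  qed
  ultimately show ?thesis
    by (simp add: one_realization_def is_mixed_hypergraph_G_star)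
qed

end

theorem theorem2p4:
  fixes n :: "nat list" and S :: "nat set"
  assumes "n \<noteq> []"
    and "sorted_wrt (>) n"
    and "2 \<le> coord n (length n)"
    and "S = set n"
    and "coord n 1 - 1 \<in> S"
  shows "one_realization (G_star n) S"
proof -
  have less: "n ! k < n ! i" if "i < k" "k < length n" for i k
    using assms(2) that by (simp add: sorted_wrt_iff_nth_less)
  obtain i where i: "i < length n" "n ! i = n ! 0 - 1"
    using assms(4,5) by (auto simp: in_set_conv_nth)
  have "2 \<le> n ! 0" using less[of 0 "length n - 1"] assms(1,3) by (cases "length n = 1") auto
  with i have "i \<noteq> 0" by (intro notI) simp
  \<comment> \<open>A later position would force \<open>n ! 1\<close> strictly between
    \<open>n ! 0 - 1\<close> and \<open>n ! 0\<close>. The value 1 also shows that \<open>n\<close>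
    has at least two entries.\<close>
  have "i = 1"
  proof (rule ccontr)
    assume "i \<noteq> 1"
    with \<open>i \<noteq> 0\<close> i have "n ! i < n ! 1" "n ! 1 < n ! 0" by (intro less; linarith)+
    with i show False by linarith
  qed
  with i assms interpret consecutive_construction n
    by unfold_locales auto
  show ?thesis using one_realization_G_star assms(4) by simp
qed

end
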